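(* The Riemann zeta function $\zeta(x)=\sum_{n=1}^{\infty}\frac{1}{n^x}$ is log-convex for $x>1$; that is, for all real $x,y>1$ and all $\lambda\in[0,1]$, $$\zeta(\lambda x+(1-\lambda)y)\leq \zeta(x)^{\lambda}\,\zeta(y)^{1-\lambda}.$$
   Context: A positive function $f$ on a real interval $I$ is called log-convex on $I$ if $f(\lambda x+(1-\lambda)y)\leq f(x)^{\lambda}f(y)^{1-\lambda}$ for all $x,y\in I$ and $\lambda\in[0,1]$. *)

theory Defs
  imports "HOL-Analysis.Analysis"
begin

text \<open>The sum starts at \<open>n = 1\<close> via the index shift \<open>Suc n\<close>. The series converges exactly
  for \<open>x > 1\<close>; values of \<open>zeta\<close> at other arguments carry no meaning.\<close>

definition zeta :: "real \<Rightarrow> real" where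
  "zeta x = (\<Sum>n. 1 / real (Suc n) powr x)"

definition log_convex_on :: "real set \<Rightarrow> (real \<Rightarrow> real) \<Rightarrow> bool" where
  "log_convex_on I f \<longleftrightarrow>
     is_interval I \<and>
     (\<forall>x\<in>I. f x > 0) \<and>
     (\<forall>x\<in>I. \<forall>y\<in>I. \<forall>l\<in>{0..1}.
        f (l * x + (1 - l) * y) \<le> f x powr l * f y powr (1 - l))"

end

theory Submission
  imports Defs
begin

text \<open>
  Each summand is exactly log-affine in the exponent:
  \<open>n\<^bsup>-(l x + (1 - l) y)\<^esup> = (n\<^bsup>-x\<^esup>)\<^bsup>l\<^esup> (n\<^bsup>-y\<^esup>)\<^bsup>1 - l\<^esup>\<close>. So the claim is Hoelder's
  inequality with weights \<open>l\<close> and \<open>1 - l\<close> for the sequences \<open>n\<^bsup>-x\<^esup>\<close> and \<open>n\<^bsup>-y\<^esup>\<close>, whose sums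
  are finite because \<open>x, y > 1\<close>. Hoelder's inequality in turn is Young's inequality
  \<open>u\<^bsup>l\<^esup> v\<^bsup>1 - l\<^esup> \<le> l u + (1 - l) v\<close>, applied termwise after both series are scaled to have
  sum \<open>1\<close>, and then summed.
\<close>

text \<open>
  The weights are kept in the form \<open>p\<close>, \<open>q\<close> with \<open>p + q = 1\<close> instead of the conjugate
  exponents \<open>1 / p\<close> and \<open>1 / q\<close>, so that the endpoints \<open>p = 0\<close> and \<open>q = 0\<close> are included.
  There \<open>0 powr 0 = 0\<close> is harmless: a vanishing entry kills its summand on the left, and the
  right-hand side vanishes only if one of the sequences is identically zero.
\<close>

lemma Hoelder_suminf_powr:
  fixes a b :: "nat \<Rightarrow> real"
  assumes p: "0 \<le> p" and q: "0 \<le> q" and pq: "p + q = 1"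
    and a: "summable a" "\<And>n. 0 \<le> a n"
    and b: "summable b" "\<And>n. 0 \<le> b n"
  shows "(\<Sum>n. a n powr p * b n powr q) \<le> suminf a powr p * suminf b powr q"
proof (cases "suminf a = 0 \<or> suminf b = 0")
  case True
  then have "(\<forall>n. a n = 0) \<or> (\<forall>n. b n = 0)"
    using a b by (simp add: suminf_eq_zero_iff)
  then have "(\<lambda>n. a n powr p * b n powr q) = (\<lambda>n. 0)"
    by auto
  then show ?thesis
    by simp
next
  case False
  define A B where "A = suminf a" and "B = suminf b"
  have AB: "A > 0" "B > 0"
    using False a b by (auto simp: A_def B_def less_le suminf_nonneg)
  \<comment> \<open>the factor that undoes the scaling of both series to sum \<open>1\<close>\<close>
  define C where "C = A powr p * B powr q"
  let ?g = "\<lambda>n. C * (p * (a n / A) + q * (b n / B))"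
  have le: "a n powr p * b n powr q \<le> ?g n" for n
  proof (cases "a n = 0 \<or> b n = 0")
    case True
    have "0 \<le> ?g n"
      using AB p q a(2) b(2) by (simp add: C_def)
    with True show ?thesis
      by auto
  next
    case False
    then have pos: "a n > 0" "b n > 0"
      using a(2) b(2) by (simp_all add: less_le)
    have "a n powr p * b n powr q = C * ((a n / A) powr p * (b n / B) powr q)"
      using pos AB by (simp add: C_def powr_divide)
    also have "\<dots> \<le> ?g n"
      using pos AB p q pq
      by (intro mult_left_mono Youngs_inequality_0) (auto simp: C_def)
    finally show ?thesis .
  qed
  have "(\<lambda>n. p * (a n / A) + q * (b n / B)) sums (p * (A / A) + q * (B / B))"
    unfolding A_def B_def
    by (intro sums_add sums_mult sums_divide summable_sums a b)
  from sums_mult[OF this, of C] have g: "?g sums C"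
    using AB pq by simp
  have "summable (\<lambda>n. a n powr p * b n powr q)"
    using le by (intro summable_comparison_test'[OF sums_summable[OF g]]) simp
  from suminf_le[OF le this sums_summable[OF g]] show ?thesis
    using sums_unique[OF g] by (simp add: C_def A_def B_def)
qed

lemma summable_zeta:
  assumes "x > 1"
  shows "summable (\<lambda>n. 1 / real (Suc n) powr x)"
proof -
  have "summable (\<lambda>n. real n powr - x)"
    using assms by (simp add: summable_real_powr_iff)
  then have "summable (\<lambda>n. real (Suc n) powr - x)"
    by (subst summable_Suc_iff)
  then show ?thesis
    by (simp only: powr_minus_divide)
qed

theorem lemma2p1: "log_convex_on {1<..} zeta"
  unfolding log_convex_on_def
proof (intro conjI ballI)
  show "is_interval {1::real<..}"
    by (rule is_interval_oi)
next
  fix x :: real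
  assume "x \<in> {1<..}"
  then show "zeta x > 0"
    unfolding zeta_def by (intro suminf_pos summable_zeta) auto
next
  fix x y l :: real
  assume x: "x \<in> {1<..}" and y: "y \<in> {1<..}" and l: "l \<in> {0..1}"
  have "1 / real (Suc n) powr (l * x + (1 - l) * y) =
      (1 / real (Suc n) powr x) powr l * (1 / real (Suc n) powr y) powr (1 - l)" for n
    by (simp add: powr_divide powr_powr powr_add mult.commute)
  then have "zeta (l * x + (1 - l) * y) =
      (\<Sum>n. (1 / real (Suc n) powr x) powr l * (1 / real (Suc n) powr y) powr (1 - l))"
    unfolding zeta_def by (simp only:)
  also have "\<dots> \<le> zeta x powr l * zeta y powr (1 - l)"
    unfolding zeta_def using x y l
    by (intro Hoelder_suminf_powr summable_zeta) auto
  finally show "zeta (l * x + (1 - l) * y) \<le> zeta x powr l * zeta y powr (1 - l)" .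
qed

end
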